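(* Let $r\in(0,1)$ be the selection probability of the random-scan Gibbs kernel $P_{\mathrm{RG}}$, let $t_1,t_2>0$ be constants, and let $k_{\mathrm{D}},k_{\mathrm{R}}>0$ be such that \[\frac{k_{\mathrm{R}}}{k_{\mathrm{D}}}=\frac{t_1+t_2}{r t_1+(1-r)t_2}.\] Then \[\rho(P_{\mathrm{DG}})^{k_{\mathrm{D}}}\le \rho(P_{\mathrm{RG}})^{k_{\mathrm{R}}}.\]
   Context: Setting. $(\mathsf{X}\times\mathsf{Y},\mathcal{F}_X\times\mathcal{F}_Y)$ is a product measurable space with a joint probability distribution $\Pi(dx,dy)$; $\Pi_X,\Pi_Y$ are its marginals and $\Pi_{X|Y}(dx|y)$, $\Pi_{Y|X}(dy|x)$ its full conditional distributions (regular conditional probabilities). Standing assumption: there exist disjoint $A_1,A_2\in\mathcal{F}_X$ with $\Pi_X(A_1),\Pi_X(A_2)>0$ and disjoint $B_1,B_2\in\mathcal{F}_Y$ with $\Pi_Y(B_1),\Pi_Y(B_2)>0$. Kernels on $\mathsf{X}\times\mathsf{Y}$ ($\delta_x,\delta_y$ are point masses), both having $\Pi$ as invariant distribution: \[P_{\mathrm{DG}}((x,y),(dx',dy'))=\Pi_{X|Y}(dx'|y')\,\Pi_{Y|X}(dy'|x),\] \[P_{\mathrm{RG}}((x,y),(dx',dy'))=r\,\Pi_{X|Y}(dx'|y)\,\delta_y(dy')+(1-r)\,\Pi_{Y|X}(dy'|x)\,\delta_x(dx').\] Interpretation: $t_1$ and $t_2$ are the (constant) times needed to sample from $\Pi_{X|Y}$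 and $\Pi_{Y|X}$ respectively, and $k_{\mathrm{D}}$, $k_{\mathrm{R}}$ are the numbers of iterations of the deterministic-scan and random-scan Gibbs samplers that can be run in unit time. $L^2$ convergence rate. Let $P$ be a Markov transition kernel with invariant probability measure $\omega$. $L^2(\omega)$ is the real Hilbert space of square-integrable real functions, and $L_0^2(\omega)=\{f\in L^2(\omega):\int f\,d\omega=0\}$. For probability measures $\mu,\nu$, $\|\mu-\nu\|_\omega=\sup\{|\int f\,d\mu-\int f\,d\nu|: f\in L_0^2(\omega),\|f\|_\omega=1\}$. $L_*^2(\omega)$ is the set of probability measures $\mu$ with $d\mu/d\omega\in L^2(\omega)$. $(\mu P^n)(A)=\int \mu(dz)P^n(z,A)$, where $P^n$ is the $n$-step kernel. The $L^2$ convergence rate $\rho(P)$ is the infimum of $\rho\in[0,1]$ such that for each $\mu\in L_*^2(\omega)$ there is $C_\mu<\infty$ with $\|\mu P^n-\omega\|_\omega<C_\mu\rho^n$ for every positive integer $n$. *)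

theory Defs
  imports "HOL-Probability.Probability"
begin

(* Functions are not identified when equal almost everywhere; every notion below
   is invariant under changing f on a null set of w. *)
definition L2 :: "'c measure \<Rightarrow> ('c \<Rightarrow> real) set" where
  "L2 w = {f \<in> borel_measurable w. integrable w (\<lambda>z. (f z)\<^sup>2)}"

definition L2_norm :: "'c measure \<Rightarrow> ('c \<Rightarrow> real) \<Rightarrow> real" where
  "L2_norm w f = sqrt (\<integral>z. (f z)\<^sup>2 \<partial>w)"

definition L2_0 :: "'c measure \<Rightarrow> ('c \<Rightarrow> real) set" where
  "L2_0 w = {f \<in> L2 w. (\<integral>z. f z \<partial>w) = 0}"

definition L2_star :: "'c measure \<Rightarrow> 'c measure set" where
  "L2_star w = {\<mu>. prob_space \<mu> \<and> sets \<mu> = sets w \<and> absolutely_continuous w \<mu> \<and>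
                   (\<lambda>z. enn2real (RN_deriv w \<mu> z)) \<in> L2 w}"

(* The supremum is taken in the extended nonnegative reals, so that it is
   meaningful even when the set of values is unbounded. *)
definition L2_dist :: "'c measure \<Rightarrow> 'c measure \<Rightarrow> 'c measure \<Rightarrow> ennreal" where
  "L2_dist w \<mu> \<nu> =
     (SUP f \<in> {f \<in> L2_0 w. L2_norm w f = 1}. ennreal \<bar>(\<integral>z. f z \<partial>\<mu>) - (\<integral>z. f z \<partial>\<nu>)\<bar>)"

(* The first argument only supplies the sigma-algebra of the state space. *)
fun kernel_pow :: "'c measure \<Rightarrow> ('c \<Rightarrow> 'c measure) \<Rightarrow> nat \<Rightarrow> 'c \<Rightarrow> 'c measure" where
  "kernel_pow M P 0 z = return M z"
| "kernel_pow M P (Suc n) z = bind (P z) (kernel_pow M P n)"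

(* The set always contains 1 when w is invariant for P, so the real infimum is proper. *)
definition L2_rate :: "'c measure \<Rightarrow> ('c \<Rightarrow> 'c measure) \<Rightarrow> real" where
  "L2_rate w P = Inf {\<rho> \<in> {0..1}. \<forall>\<mu> \<in> L2_star w. \<exists>C::real. \<forall>n\<ge>1.
      L2_dist w (bind \<mu> (kernel_pow w P n)) w < ennreal (C * \<rho> ^ n)}"

definition marginal_X :: "'a measure \<Rightarrow> ('a \<times> 'b) measure \<Rightarrow> 'a measure" where
  "marginal_X X J = distr J X fst"

definition marginal_Y :: "'b measure \<Rightarrow> ('a \<times> 'b) measure \<Rightarrow> 'b measure" where
  "marginal_Y Y J = distr J Y snd"

(* Regular conditional probabilities: Markov kernels disintegrating the joint law.
   K y is the conditional law of the X-coordinate given the Y-coordinate y. *)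
definition full_conditional_XY ::
  "'a measure \<Rightarrow> 'b measure \<Rightarrow> ('a \<times> 'b) measure \<Rightarrow> ('b \<Rightarrow> 'a measure) \<Rightarrow> bool" where
  "full_conditional_XY X Y J K \<longleftrightarrow> K \<in> measurable Y (prob_algebra X) \<and>
     (\<forall>A\<in>sets X. \<forall>B\<in>sets Y.
        emeasure J (A \<times> B) = (\<integral>\<^sup>+ y\<in>B. emeasure (K y) A \<partial>marginal_Y Y J))"

definition full_conditional_YX ::
  "'a measure \<Rightarrow> 'b measure \<Rightarrow> ('a \<times> 'b) measure \<Rightarrow> ('a \<Rightarrow> 'b measure) \<Rightarrow> bool" where
  "full_conditional_YX X Y J K \<longleftrightarrow> K \<in> measurable X (prob_algebra Y) \<and>
     (\<forall>A\<in>sets X. \<forall>B\<in>sets Y.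
        emeasure J (A \<times> B) = (\<integral>\<^sup>+ x\<in>A. emeasure (K x) B \<partial>marginal_X X J))"

definition DG_kernel ::
  "'a measure \<Rightarrow> 'b measure \<Rightarrow> ('b \<Rightarrow> 'a measure) \<Rightarrow> ('a \<Rightarrow> 'b measure) \<Rightarrow>
   'a \<times> 'b \<Rightarrow> ('a \<times> 'b) measure" where
  "DG_kernel X Y KXY KYX = (\<lambda>(x, y). bind (KYX x) (\<lambda>y'. KXY y' \<Otimes>\<^sub>M return Y y'))"

definition RG_kernel ::
  "'a measure \<Rightarrow> 'b measure \<Rightarrow> real \<Rightarrow> ('b \<Rightarrow> 'a measure) \<Rightarrow> ('a \<Rightarrow> 'b measure) \<Rightarrow>
   'a \<times> 'b \<Rightarrow> ('a \<times> 'b) measure" where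
  "RG_kernel X Y r KXY KYX = (\<lambda>(x, y).
     measure_of (space (X \<Otimes>\<^sub>M Y)) (sets (X \<Otimes>\<^sub>M Y))
       (\<lambda>E. ennreal r * emeasure (KXY y \<Otimes>\<^sub>M return Y y) E
          + ennreal (1 - r) * emeasure (return X x \<Otimes>\<^sub>M KYX x) E))"

end

theory Submission
  imports Defs
begin

text \<open>
Let \<open>T1\<close> and \<open>T2\<close> be the operators on functions that resample the first and the second coordinate
from its conditional law. Both are conditional expectations, hence self-adjoint idempotents of
\<open>L2\<close> that preserve the mean. The random-scan operator is \<open>R = r T1 + (1 - r) T2\<close>, and the
deterministic-scan operator is \<open>T2 T1\<close>. Call \<open>g\<close> a contraction factor if
\<open>\<parallel>T1 f\<parallel>\<^sup>2 \<le> g \<parallel>f\<parallel>\<^sup>2\<close> for all mean-zero \<open>f\<close> with \<open>T2 f = f\<close>; the least one is the squared maximal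
correlation of the two coordinates.

The random-scan rate is bounded from below by Rayleigh quotients: a mean-zero \<open>f\<close> satisfies
\<open>\<langle>f, R f\<rangle> \<le> \<rho> \<parallel>f\<parallel>\<^sup>2\<close> for each admissible \<open>\<rho>\<close> (\<open>admissible_imp_rayleigh_le\<close>). No spectral theorem is
involved: iterating Cauchy-Schwarz gives \<open>\<langle>f, R\<^sup>n f\<rangle> \<ge> a\<^sup>n\<close> for \<open>n = 2\<^sup>k\<close>, where \<open>\<parallel>f\<parallel> = 1\<close> and
\<open>a = \<langle>f, R f\<rangle> \<ge> 0\<close>, and the initial law with density proportional to \<open>c + f\<close> sees this decay. If \<open>T2 f = f\<close> the
quotient is \<open>r \<parallel>T1 f\<parallel>\<^sup>2 / \<parallel>f\<parallel>\<^sup>2 + (1 - r)\<close>, so \<open>(\<rho> - (1 - r)) / r\<close>, cut off at 0, is a contraction factor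
(\<open>admissible_imp_contracts\<close>). The deterministic-scan rate is at most any contraction factor
\<open>g \<le> 1\<close>, because each of the two half steps contracts squared norms by \<open>g\<close>
(\<open>L2_rate_composed_le\<close>). Young's inequality \<open>g\<^sup>r \<le> r g + (1 - r)\<close> now bounds the deterministic-scan
rate by \<open>\<rho>\<close> to the power \<open>1 / r\<close>, and, with the two coordinates exchanged, by \<open>\<rho>\<close> to the power
\<open>1 / (1 - r)\<close>. The ratio of the iteration numbers never exceeds the larger of these two exponents.

All operator estimates are made for bounded functions, where every integral exists and iterated
kernels integrate in the expected way. Bounded functions suffice: test functions in \<open>L2\<close> are
recovered by truncation (\<open>L2_dist_le\<close>), and the lower bound uses bounded test functions only.
\<close>

section \<open>Bounded measurable functions and quadratic integrals\<close>

text \<open>The bound is required only on the space, since a kernel is constrained only there.\<close>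
definition bounded_fun :: "'c measure \<Rightarrow> ('c \<Rightarrow> real) set" where
  "bounded_fun w = {f \<in> borel_measurable w. \<exists>c. \<forall>z\<in>space w. \<bar>f z\<bar> \<le> c}"

definition sqint :: "'c measure \<Rightarrow> ('c \<Rightarrow> real) \<Rightarrow> real" where
  "sqint w f = (\<integral>z. (f z)\<^sup>2 \<partial>w)"

lemma bounded_fun_measurable: "f \<in> bounded_fun w \<Longrightarrow> f \<in> borel_measurable w"
  by (simp add: bounded_fun_def)

lemma bounded_funE:
  assumes "f \<in> bounded_fun w"
  obtains c where "f \<in> borel_measurable w" "\<And>z. z \<in> space w \<Longrightarrow> \<bar>f z\<bar> \<le> c" "0 \<le> c"
proof -
  obtain c where c: "f \<in> borel_measurable w" "\<forall>z\<in>space w. \<bar>f z\<bar> \<le> c"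
    using assms by (auto simp: bounded_fun_def)
  show thesis
    by (rule that[of "\<bar>c\<bar>"]) (use c in force)+
qed

lemma bounded_funI:
  "f \<in> borel_measurable w \<Longrightarrow> (\<And>z. z \<in> space w \<Longrightarrow> \<bar>f z\<bar> \<le> c) \<Longrightarrow> f \<in> bounded_fun w"
  by (auto simp: bounded_fun_def)

lemma bounded_fun_const [simp]: "(\<lambda>_. c) \<in> bounded_fun w"
  by (rule bounded_funI[of _ _ "\<bar>c\<bar>"]) auto

lemma bounded_fun_times:
  assumes "f \<in> bounded_fun w" "g \<in> bounded_fun w"
  shows "(\<lambda>z. f z * g z) \<in> bounded_fun w"
proof -
  obtain a b where "f \<in> borel_measurable w" "\<And>z. z \<in> space w \<Longrightarrow> \<bar>f z\<bar> \<le> a" "0 \<le> a"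
      "g \<in> borel_measurable w" "\<And>z. z \<in> space w \<Longrightarrow> \<bar>g z\<bar> \<le> b" "0 \<le> b"
    by (metis assms bounded_funE)
  then show ?thesis
    by (intro bounded_funI[of _ _ "a * b"]) (auto simp: abs_mult intro!: mult_mono)
qed

lemma bounded_fun_add:
  assumes "f \<in> bounded_fun w" "g \<in> bounded_fun w"
  shows "(\<lambda>z. f z + g z) \<in> bounded_fun w"
proof -
  obtain a b where "f \<in> borel_measurable w" "\<And>z. z \<in> space w \<Longrightarrow> \<bar>f z\<bar> \<le> a" "0 \<le> a"
      "g \<in> borel_measurable w" "\<And>z. z \<in> space w \<Longrightarrow> \<bar>g z\<bar> \<le> b" "0 \<le> b"
    by (metis assms bounded_funE)
  then show ?thesis
    by (intro bounded_funI[of _ _ "a + b"]) (auto intro!: abs_triangle_ineq[THEN order_trans] add_mono)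
qed

lemma bounded_fun_cmult: "f \<in> bounded_fun w \<Longrightarrow> (\<lambda>z. c * f z) \<in> bounded_fun w"
  by (rule bounded_fun_times) auto

lemma bounded_fun_diff:
  assumes "f \<in> bounded_fun w" "g \<in> bounded_fun w"
  shows "(\<lambda>z. f z - g z) \<in> bounded_fun w"
  using bounded_fun_add[OF assms(1) bounded_fun_cmult[OF assms(2), of "-1"]] by simp

lemma bounded_fun_power2: "f \<in> bounded_fun w \<Longrightarrow> (\<lambda>z. (f z)\<^sup>2) \<in> bounded_fun w"
  unfolding power2_eq_square by (rule bounded_fun_times)

lemmas bounded_fun_intros = bounded_fun_times bounded_fun_add bounded_fun_diff bounded_fun_cmult
  bounded_fun_power2 bounded_fun_const

lemma bounded_fun_sets_cong: "sets M = sets N \<Longrightarrow> bounded_fun M = bounded_fun N"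
  by (auto simp: bounded_fun_def cong: measurable_cong_sets dest: sets_eq_imp_space_eq)

lemma (in finite_measure) integrable_bounded_fun:
  assumes "f \<in> bounded_fun M" shows "integrable M f"
proof -
  obtain c where "f \<in> borel_measurable M" "\<And>z. z \<in> space M \<Longrightarrow> \<bar>f z\<bar> \<le> c"
    using assms by (metis bounded_funE)
  then show ?thesis
    by (intro integrable_const_bound[of _ c]) auto
qed

lemma sqint_nonneg [simp]: "0 \<le> sqint w f"
  by (simp add: sqint_def)

lemma sqint_cong: "(\<And>z. z \<in> space w \<Longrightarrow> f z = g z) \<Longrightarrow> sqint w f = sqint w g"
  unfolding sqint_def by (rule Bochner_Integration.integral_cong) auto

lemma sqint_zero_imp:
  assumes "f \<in> borel_measurable w" "integrable w (\<lambda>z. (f z)\<^sup>2)" "sqint w f = 0"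
  shows "AE z in w. f z = 0"
  using integral_nonneg_eq_0_iff_AE[OF assms(2)] assms(3) by (simp add: sqint_def)

lemma integrable_mult_square_integrable:
  fixes f g :: "'c \<Rightarrow> real"
  assumes [measurable]: "f \<in> borel_measurable w" "g \<in> borel_measurable w"
    and "integrable w (\<lambda>z. (f z)\<^sup>2)" "integrable w (\<lambda>z. (g z)\<^sup>2)"
  shows "integrable w (\<lambda>z. f z * g z)"
proof (rule Bochner_Integration.integrable_bound)
  show "integrable w (\<lambda>z. (f z)\<^sup>2 + (g z)\<^sup>2)"
    using assms by auto
  have "\<bar>a * b\<bar> \<le> a\<^sup>2 + b\<^sup>2" for a b :: real
  proof -
    have "2 * \<bar>a * b\<bar> \<le> a\<^sup>2 + b\<^sup>2"
      using sum_squares_bound[of "\<bar>a\<bar>" "\<bar>b\<bar>"] by (simp add: abs_mult)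
    then show ?thesis by linarith
  qed
  then show "AE z in w. norm (f z * g z) \<le> norm ((f z)\<^sup>2 + (g z)\<^sup>2)"
    by auto
qed measurable

lemma Cauchy_Schwarz_sqint:
  assumes [measurable]: "f \<in> borel_measurable w" "g \<in> borel_measurable w"
    and f: "integrable w (\<lambda>z. (f z)\<^sup>2)" and g: "integrable w (\<lambda>z. (g z)\<^sup>2)"
  shows "(\<integral>z. f z * g z \<partial>w)\<^sup>2 \<le> sqint w f * sqint w g"
proof (cases "sqint w g = 0")
  case True
  have "AE z in w. g z = 0"
    using sqint_zero_imp[OF _ g True] by simp
  then have "(\<integral>z. f z * g z \<partial>w) = (\<integral>z. 0 \<partial>w)"
    by (intro integral_cong_AE) auto
  then show ?thesis by simp
next
  case False
  then have pos: "sqint w g > 0"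
    using sqint_nonneg[of w g] by linarith
  note fg = integrable_mult_square_integrable[OF assms]
  define t where "t = (\<integral>z. f z * g z \<partial>w) / sqint w g"
  have "0 \<le> (\<integral>z. (f z - t * g z)\<^sup>2 \<partial>w)" by simp
  also have "\<dots> = (\<integral>z. ((f z)\<^sup>2 - 2 * t * (f z * g z)) + t\<^sup>2 * (g z)\<^sup>2 \<partial>w)"
    by (intro Bochner_Integration.integral_cong) (auto simp: power2_eq_square algebra_simps)
  also have "\<dots> = sqint w f - 2 * t * (\<integral>z. f z * g z \<partial>w) + t\<^sup>2 * sqint w g"
    using f g fg by (simp add: sqint_def)
  also have "\<dots> = sqint w f - (\<integral>z. f z * g z \<partial>w)\<^sup>2 / sqint w g"
    using pos by (simp add: t_def field_simps power2_eq_square)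
  finally show ?thesis
    using pos by (simp add: field_simps)
qed

lemma (in finite_measure) Cauchy_Schwarz_bounded:
  assumes "f \<in> bounded_fun M" "g \<in> bounded_fun M"
  shows "(\<integral>z. f z * g z \<partial>M)\<^sup>2 \<le> sqint M f * sqint M g"
  using assms by (intro Cauchy_Schwarz_sqint integrable_bounded_fun bounded_fun_power2)
    (auto simp: bounded_fun_measurable)

lemma integral_bind_bounded:
  assumes M: "M \<in> space (prob_algebra N)" and K: "K \<in> N \<rightarrow>\<^sub>M prob_algebra L"
    and f: "f \<in> bounded_fun L"
  shows "(\<integral>z. f z \<partial>(bind M K)) = (\<integral>x. (\<integral>z. f z \<partial>K x) \<partial>M)"
proof -
  interpret prob_space M using M by (simp add: space_prob_algebra)
  have sets: "sets M = sets N" using M by (simp add: space_prob_algebra)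
  have K': "K \<in> M \<rightarrow>\<^sub>M subprob_algebra L"
    using measurable_prob_algebraD[OF K] sets by (simp cong: measurable_cong_sets)
  obtain c where c: "f \<in> borel_measurable L" "\<And>z. z \<in> space L \<Longrightarrow> \<bar>f z\<bar> \<le> c"
    using f by (metis bounded_funE)
  have "(\<integral>z. f z \<partial>(bind M K)) = (\<integral>z. f z \<partial>join (distr M (subprob_algebra L) K))"
    using bind_nonempty''[OF K' not_empty] by simp
  also have "\<dots> = (\<integral>M'. (\<integral>z. f z \<partial>M') \<partial>distr M (subprob_algebra L) K)"
  proof (rule integral_join[OF c, where B'=1])
    show "finite_measure (distr M (subprob_algebra L) K)"
      using K' by (rule finite_measure_distr)
    show "AE M' in distr M (subprob_algebra L) K. emeasure M' (space M') \<le> ennreal 1"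
      by (auto simp: space_subprob_algebra subprob_space.emeasure_space_le_1)
  qed auto
  also have "\<dots> = (\<integral>x. (\<integral>z. f z \<partial>K x) \<partial>M)"
    by (rule integral_distr[OF K']) (use c in measurable)
  finally show ?thesis .
qed

section \<open>Markov kernels as operators\<close>

definition kop :: "('c \<Rightarrow> 'c measure) \<Rightarrow> ('c \<Rightarrow> real) \<Rightarrow> 'c \<Rightarrow> real" where
  "kop P f z = (\<integral>u. f u \<partial>P z)"

locale markov_kernel = prob_space w for w :: "'c measure" +
  fixes P :: "'c \<Rightarrow> 'c measure"
  assumes kernel [measurable]: "P \<in> w \<rightarrow>\<^sub>M prob_algebra w"
begin

lemma prob_kernel: "z \<in> space w \<Longrightarrow> prob_space (P z)"
  and sets_kernel: "z \<in> space w \<Longrightarrow> sets (P z) = sets w"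
  and space_kernel: "z \<in> space w \<Longrightarrow> space (P z) = space w"
  using measurable_space[OF kernel, of z] by (auto simp: space_prob_algebra dest: sets_eq_imp_space_eq)

lemma kop_cong:
  "(\<And>u. u \<in> space w \<Longrightarrow> f u = g u) \<Longrightarrow> z \<in> space w \<Longrightarrow> kop P f z = kop P g z"
  unfolding kop_def by (rule Bochner_Integration.integral_cong) (auto simp: space_kernel)

lemma integrable_kernel: "f \<in> bounded_fun w \<Longrightarrow> z \<in> space w \<Longrightarrow> integrable (P z) f"
  using prob_kernel sets_kernel bounded_fun_sets_cong
  by (metis finite_measure.integrable_bounded_fun prob_space.finite_measure)

lemma kop_bounded: assumes f: "f \<in> bounded_fun w" shows "kop P f \<in> bounded_fun w"
proof -
  obtain c where c [measurable]: "f \<in> borel_measurable w"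
      and le: "\<And>z. z \<in> space w \<Longrightarrow> \<bar>f z\<bar> \<le> c"
    using f by (metis bounded_funE)
  show ?thesis
  proof (rule bounded_funI[of _ _ c])
    have [measurable]: "P \<in> w \<rightarrow>\<^sub>M subprob_algebra w"
      by (rule measurable_prob_algebraD[OF kernel])
    show "kop P f \<in> borel_measurable w"
      unfolding kop_def by measurable
    fix z assume z: "z \<in> space w"
    interpret Pz: prob_space "P z" using z by (rule prob_kernel)
    have "f u \<le> c \<and> - c \<le> f u" if "u \<in> space (P z)" for u
      using le[of u] that z by (auto simp: space_kernel abs_le_iff)
    then show "\<bar>kop P f z\<bar> \<le> c"
      unfolding kop_def abs_le_iff
      using Pz.integral_le_const[OF integrable_kernel[OF f z], of c]
        Pz.integral_ge_const[OF integrable_kernel[OF f z], of "-c"] by auto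
  qed
qed

lemma kop_const: "z \<in> space w \<Longrightarrow> kop P (\<lambda>_. c) z = c"
  using prob_space.prob_space[OF prob_kernel] by (simp add: kop_def)

lemma kop_square_le:
  assumes f: "f \<in> bounded_fun w" and z: "z \<in> space w"
  shows "(kop P f z)\<^sup>2 \<le> kop P (\<lambda>u. (f u)\<^sup>2) z"
proof -
  interpret Pz: prob_space "P z" using z by (rule prob_kernel)
  have "f \<in> bounded_fun (P z)"
    using f z sets_kernel bounded_fun_sets_cong by blast
  from Pz.Cauchy_Schwarz_bounded[OF this bounded_fun_const[of 1]] show ?thesis
    by (simp add: kop_def sqint_def Pz.prob_space)
qed

lemma kernel_pow_measurable [measurable]: "kernel_pow w P n \<in> w \<rightarrow>\<^sub>M prob_algebra w"
proof (induction n)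
  case 0
  have "kernel_pow w P 0 = return w" by (rule ext) simp
  then show ?case by simp
next
  case (Suc n)
  have "kernel_pow w P (Suc n) = (\<lambda>z. bind (P z) (kernel_pow w P n))" by (rule ext) simp
  with measurable_bind_prob_space[OF kernel Suc] show ?case by simp
qed

lemma kop_pow_bounded: "f \<in> bounded_fun w \<Longrightarrow> (kop P ^^ n) f \<in> bounded_fun w"
  by (induction n) (auto intro: kop_bounded)

lemma integral_kernel_pow:
  assumes f: "f \<in> bounded_fun w" and z: "z \<in> space w"
  shows "(\<integral>u. f u \<partial>kernel_pow w P n z) = (kop P ^^ n) f z"
  using z
proof (induction n arbitrary: z)
  case 0
  then show ?case using f by (simp add: integral_return bounded_fun_measurable)
next
  case (Suc n)
  have "(\<integral>u. f u \<partial>kernel_pow w P (Suc n) z) = (\<integral>x. (\<integral>u. f u \<partial>kernel_pow w P n x) \<partial>P z)"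
    unfolding kernel_pow.simps
    by (rule integral_bind_bounded[OF _ kernel_pow_measurable f])
      (rule measurable_space[OF kernel Suc.prems])
  also have "\<dots> = (kop P ^^ Suc n) f z"
    unfolding funpow.simps o_apply kop_def[of P "(kop P ^^ n) f"]
    by (rule Bochner_Integration.integral_cong) (auto simp: space_kernel Suc)
  finally show ?case .
qed

lemma integral_bind_kernel_pow:
  assumes "f \<in> bounded_fun w" "\<mu> \<in> space (prob_algebra w)"
  shows "(\<integral>u. f u \<partial>bind \<mu> (kernel_pow w P n)) = (\<integral>z. (kop P ^^ n) f z \<partial>\<mu>)"
proof -
  have "space \<mu> = space w" 
    using assms(2) by (auto simp: space_prob_algebra dest: sets_eq_imp_space_eq)
  then show ?thesis
    unfolding integral_bind_bounded[OF assms(2) kernel_pow_measurable assms(1)]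
    by (intro Bochner_Integration.integral_cong) (auto simp: integral_kernel_pow assms(1))
qed

end

section \<open>Admissible rates\<close>

definition admissible_rate :: "'c measure \<Rightarrow> ('c \<Rightarrow> 'c measure) \<Rightarrow> real \<Rightarrow> bool" where
  "admissible_rate w P \<rho> \<longleftrightarrow> (\<forall>\<mu> \<in> L2_star w. \<exists>C::real. \<forall>n\<ge>1.
      L2_dist w (bind \<mu> (kernel_pow w P n)) w < ennreal (C * \<rho> ^ n))"

lemma L2_rate_alt: "L2_rate w P = Inf {\<rho> \<in> {0..1}. admissible_rate w P \<rho>}"
  by (simp add: L2_rate_def admissible_rate_def)

lemma L2_rate_le: "0 \<le> \<rho> \<Longrightarrow> \<rho> \<le> 1 \<Longrightarrow> admissible_rate w P \<rho> \<Longrightarrow> L2_rate w P \<le> \<rho>"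
  unfolding L2_rate_alt by (rule cInf_lower) (auto intro: bdd_belowI[of _ 0])

text \<open>The truncations do not depend on the measure, so one sequence serves two laws at once.\<close>
lemma integral_truncation_tendsto:
  fixes f :: "'c \<Rightarrow> real"
  assumes f: "integrable M f"
  shows "(\<lambda>m. \<integral>z. max (- real m) (min (real m) (f z)) \<partial>M) \<longlonglongrightarrow> (\<integral>z. f z \<partial>M)"
proof (rule integral_dominated_convergence)
  show "integrable M (\<lambda>z. \<bar>f z\<bar>)" using f by simp
  show "AE z in M. (\<lambda>m. max (- real m) (min (real m) (f z))) \<longlonglongrightarrow> f z"
  proof (rule AE_I2, rule tendsto_eventually)
    fix z
    obtain m0 :: nat where "\<bar>f z\<bar> \<le> real m0"
      using real_arch_simple by blast
    then show "\<forall>\<^sub>F m in sequentially. max (- real m) (min (real m) (f z)) = f z"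
      by (intro eventually_sequentiallyI[of m0]) auto
  qed
qed (use f in auto)

lemma (in prob_space) sqint_centered_le:
  assumes f: "f \<in> bounded_fun M"
  shows "sqint M (\<lambda>z. f z - (\<integral>u. f u \<partial>M)) \<le> sqint M f"
proof -
  define m where "m = (\<integral>u. f u \<partial>M)"
  note int = integrable_bounded_fun[OF f] integrable_bounded_fun[OF bounded_fun_power2[OF f]]
  have "sqint M (\<lambda>z. f z - m) = (\<integral>z. ((f z)\<^sup>2 - 2 * m * f z) + m\<^sup>2 \<partial>M)"
    unfolding sqint_def
    by (intro Bochner_Integration.integral_cong) (auto simp: power2_eq_square algebra_simps)
  also have "\<dots> = sqint M f - m\<^sup>2"
    using int by (simp add: sqint_def prob_space power2_eq_square flip: m_def)
  finally show ?thesis by (simp add: m_def)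
qed

text \<open>
A square-integrable test function may fail to be integrable under \<open>N\<close>; its Bochner integral is then 0,
and so is its mean under \<open>M\<close>, so it adds nothing to the supremum. Otherwise it is the limit of its
truncations, which do not increase the norm and are bounded. Truncation destroys the mean-zero
condition; subtracting the mean restores it and does not increase the norm either.
\<close>
lemma (in prob_space) L2_dist_le:
  assumes N: "prob_space N" "sets N = sets M" and D: "0 \<le> D"
    and le: "\<And>f. f \<in> bounded_fun M \<Longrightarrow> (\<integral>z. f z \<partial>M) = 0 \<Longrightarrow> \<bar>\<integral>z. f z \<partial>N\<bar> \<le> D * sqrt (sqint M f)"
  shows "L2_dist M N M \<le> ennreal D"
  unfolding L2_dist_def
proof (rule SUP_least)
  fix f assume "f \<in> {f \<in> L2_0 M. L2_norm M f = 1}"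
  then have f [measurable]: "f \<in> borel_measurable M" and f2: "integrable M (\<lambda>z. (f z)\<^sup>2)"
    and f0: "(\<integral>z. f z \<partial>M) = 0" and norm: "sqint M f = 1"
    by (auto simp: L2_0_def L2_def L2_norm_def sqint_def)
  interpret N: prob_space N by (rule N)
  have fM: "integrable M f"
    by (rule square_integrable_imp_integrable) (use f f2 in auto)
  show "ennreal \<bar>(\<integral>z. f z \<partial>N) - (\<integral>z. f z \<partial>M)\<bar> \<le> ennreal D"
  proof (cases "integrable N f")
    case False
    then show ?thesis using f0 D by (simp add: not_integrable_integral_eq)
  next
    case True
    define F where "F m z = max (- real m) (min (real m) (f z))" for m z
    have F: "F m \<in> bounded_fun M" for m
      by (rule bounded_funI[of _ _ "real m"]) (auto simp: F_def[abs_def])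
    have le_D: "\<bar>(\<integral>z. F m z \<partial>N) - (\<integral>z. F m z \<partial>M)\<bar> \<le> D" for m
    proof -
      define c where "c = (\<integral>z. F m z \<partial>M)"
      note FM = integrable_bounded_fun[OF F[of m]]
      have FN: "integrable N (F m)"
        using F[of m] N.integrable_bounded_fun bounded_fun_sets_cong[OF N(2)] by blast
      have G: "(\<lambda>z. F m z - c) \<in> bounded_fun M"
        by (intro bounded_fun_intros F)
      have G0: "(\<integral>z. F m z - c \<partial>M) = 0"
        using FM by (simp add: c_def prob_space)
      have "sqint M (\<lambda>z. F m z - c) \<le> sqint M (F m)"
        unfolding c_def by (rule sqint_centered_le[OF F])
      also have "\<dots> \<le> sqint M f"
        unfolding sqint_def
      proof (rule integral_mono[OF integrable_bounded_fun[OF bounded_fun_power2[OF F]] f2])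
        fix z
        have "\<bar>F m z\<bar> \<le> \<bar>f z\<bar>" by (auto simp: F_def)
        then show "(F m z)\<^sup>2 \<le> (f z)\<^sup>2" by (simp add: abs_le_square_iff)
      qed
      finally have "sqrt (sqint M (\<lambda>z. F m z - c)) \<le> 1"
        by (simp add: norm)
      then have "\<bar>\<integral>z. F m z - c \<partial>N\<bar> \<le> D"
        using le[OF G G0] D by (meson mult_left_le order_trans)
      moreover have "(\<integral>z. F m z - c \<partial>N) = (\<integral>z. F m z \<partial>N) - c"
        using FN by (simp add: N.prob_space)
      ultimately show ?thesis by (simp add: c_def)
    qed
    have "(\<lambda>m. \<bar>(\<integral>z. F m z \<partial>N) - (\<integral>z. F m z \<partial>M)\<bar>) \<longlonglongrightarrow> \<bar>(\<integral>z. f z \<partial>N) - (\<integral>z. f z \<partial>M)\<bar>"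
      unfolding F_def by (intro tendsto_intros integral_truncation_tendsto True fM)
    then have "\<bar>(\<integral>z. f z \<partial>N) - (\<integral>z. f z \<partial>M)\<bar> \<le> D"
      by (rule LIMSEQ_le_const2) (use le_D in blast)
    then show ?thesis by (rule ennreal_leI)
  qed
qed

lemma (in prob_space) L2_star_density:
  assumes "\<mu> \<in> L2_star M"
  obtains \<phi> where "\<phi> \<in> borel_measurable M" "integrable M (\<lambda>z. (\<phi> z)\<^sup>2)" "\<And>z. 0 \<le> \<phi> z"
    "\<mu> = density M (\<lambda>z. ennreal (\<phi> z))"
proof
  let ?\<phi> = "\<lambda>z. enn2real (RN_deriv M \<mu> z)"
  have mu: "prob_space \<mu>" "sets \<mu> = sets M" "absolutely_continuous M \<mu>" "?\<phi> \<in> L2 M"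
    using assms by (auto simp: L2_star_def)
  interpret \<mu>: prob_space \<mu> by (rule mu)
  show "?\<phi> \<in> borel_measurable M" "integrable M (\<lambda>z. (?\<phi> z)\<^sup>2)" "\<And>z. 0 \<le> ?\<phi> z"
    using mu(4) by (auto simp: L2_def)
  have "AE z in M. RN_deriv M \<mu> z \<noteq> \<infinity>"
    by (rule RN_deriv_finite) (use mu in \<open>auto intro: \<mu>.sigma_finite_measure_axioms\<close>)
  then have "density M (\<lambda>z. ennreal (?\<phi> z)) = density M (RN_deriv M \<mu>)"
    by (intro density_cong) (auto simp: less_top)
  also have "\<dots> = \<mu>" by (rule density_RN_deriv) (use mu in auto)
  finally show "\<mu> = density M (\<lambda>z. ennreal (?\<phi> z))" by simp
qed

lemma (in prob_space) L2_star_bounded_density: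
  assumes h: "h \<in> bounded_fun M" and h0: "\<And>z. z \<in> space M \<Longrightarrow> 0 \<le> h z" and h1: "(\<integral>z. h z \<partial>M) = 1"
  shows "density M (\<lambda>z. ennreal (h z)) \<in> L2_star M"
proof -
  have [measurable]: "h \<in> borel_measurable M" by (rule bounded_fun_measurable[OF h])
  have "(\<integral>\<^sup>+z. ennreal (h z) \<partial>M) = 1"
    using nn_integral_eq_integral[OF integrable_bounded_fun[OF h]] h0 h1 by simp
  then have "prob_space (density M (\<lambda>z. ennreal (h z)))"
    by (intro prob_spaceI) (simp add: emeasure_density cong: nn_integral_cong)
  moreover have "absolutely_continuous M (density M (\<lambda>z. ennreal (h z)))"
    by (rule absolutely_continuousI_density) simp
  moreover have "AE z in M. ennreal (h z) = RN_deriv M (density M (\<lambda>z. ennreal (h z))) z"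
    by (rule RN_deriv_unique) auto
  then have "AE z in M. enn2real (RN_deriv M (density M (\<lambda>z. ennreal (h z))) z) = h z"
    using AE_space by eventually_elim (metis enn2real_ennreal h0)
  then have "integrable M (\<lambda>z. (enn2real (RN_deriv M (density M (\<lambda>z. ennreal (h z))) z))\<^sup>2)
      \<longleftrightarrow> integrable M (\<lambda>z. (h z)\<^sup>2)"
    by (intro integrable_cong_AE) auto
  ultimately show ?thesis
    using integrable_bounded_fun[OF bounded_fun_power2[OF h]] by (auto simp: L2_star_def L2_def)
qed

context markov_kernel
begin

text \<open>
By Cauchy-Schwarz against the density of the initial law, a decay of the operator on mean-zero functions
becomes a decay of the laws. It serves reversible kernels and their compositions, which are in general
not reversible.
\<close>
lemma decay_imp_admissible:
  assumes \<rho>: "0 < \<rho>" and c: "0 \<le> c"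
    and decay: "\<And>n f. 1 \<le> n \<Longrightarrow> f \<in> bounded_fun w \<Longrightarrow> (\<integral>z. f z \<partial>w) = 0
      \<Longrightarrow> sqint w ((kop P ^^ n) f) \<le> (c * \<rho> ^ n)\<^sup>2 * sqint w f"
  shows "admissible_rate w P \<rho>"
  unfolding admissible_rate_def
proof
  fix \<mu> assume \<mu>: "\<mu> \<in> L2_star w"
  then have \<mu>': "\<mu> \<in> space (prob_algebra w)"
    by (simp add: L2_star_def space_prob_algebra)
  obtain \<phi> where \<phi>: "\<phi> \<in> borel_measurable w" "integrable w (\<lambda>z. (\<phi> z)\<^sup>2)" "\<And>z. 0 \<le> \<phi> z"
    and dens: "\<mu> = density w (\<lambda>z. ennreal (\<phi> z))"
    using L2_star_density[OF \<mu>] by metis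
  define C where "C = sqrt (sqint w \<phi>) * c"
  have C0: "0 \<le> C" using c by (simp add: C_def)
  show "\<exists>C. \<forall>n\<ge>1. L2_dist w (bind \<mu> (kernel_pow w P n)) w < ennreal (C * \<rho> ^ n)"
  proof (intro exI[of _ "C + 1"] allI impI)
    fix n :: nat assume n: "1 \<le> n"
    have "L2_dist w (bind \<mu> (kernel_pow w P n)) w \<le> ennreal (C * \<rho> ^ n)"
    proof (rule L2_dist_le)
      show "prob_space (bind \<mu> (kernel_pow w P n))" "sets (bind \<mu> (kernel_pow w P n)) = sets w"
        by (rule prob_space_bind'[OF \<mu>' kernel_pow_measurable], rule sets_bind'[OF \<mu>' kernel_pow_measurable])
      show "0 \<le> C * \<rho> ^ n" using C0 \<rho> by simp
      fix f assume f: "f \<in> bounded_fun w" and f0: "(\<integral>z. f z \<partial>w) = 0"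
      let ?g = "(kop P ^^ n) f"
      have g: "?g \<in> bounded_fun w" by (rule kop_pow_bounded[OF f])
      have "(\<integral>z. f z \<partial>bind \<mu> (kernel_pow w P n)) = (\<integral>z. ?g z \<partial>\<mu>)"
        by (rule integral_bind_kernel_pow[OF f \<mu>'])
      also have "\<dots> = (\<integral>z. \<phi> z * ?g z \<partial>w)"
        unfolding dens using \<phi> g by (subst integral_real_density) (auto simp: bounded_fun_measurable)
      finally have eq: "(\<integral>z. f z \<partial>bind \<mu> (kernel_pow w P n)) = (\<integral>z. \<phi> z * ?g z \<partial>w)" .
      have "(\<integral>z. \<phi> z * ?g z \<partial>w)\<^sup>2 \<le> sqint w \<phi> * sqint w ?g"
        by (rule Cauchy_Schwarz_sqint[OF \<phi>(1) bounded_fun_measurable[OF g] \<phi>(2)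
              integrable_bounded_fun[OF bounded_fun_power2[OF g]]])
      also have "\<dots> \<le> sqint w \<phi> * ((c * \<rho> ^ n)\<^sup>2 * sqint w f)"
        by (rule mult_left_mono[OF decay[OF n f f0]]) simp
      also have "\<dots> = (C * \<rho> ^ n * sqrt (sqint w f))\<^sup>2"
        by (simp add: C_def power_mult_distrib)
      finally have "\<bar>\<integral>z. \<phi> z * ?g z \<partial>w\<bar> \<le> \<bar>C * \<rho> ^ n * sqrt (sqint w f)\<bar>"
        by (simp only: abs_le_square_iff)
      also have "\<dots> = C * \<rho> ^ n * sqrt (sqint w f)"
        using C0 \<rho> by (intro abs_of_nonneg mult_nonneg_nonneg) auto
      finally show "\<bar>\<integral>z. f z \<partial>bind \<mu> (kernel_pow w P n)\<bar> \<le> C * \<rho> ^ n * sqrt (sqint w f)"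
        unfolding eq .
    qed
    also have "\<dots> < ennreal ((C + 1) * \<rho> ^ n)"
      using C0 \<rho> by (intro ennreal_lessI) (auto simp: distrib_right add_nonneg_pos)
    finally show "L2_dist w (bind \<mu> (kernel_pow w P n)) w < ennreal ((C + 1) * \<rho> ^ n)" .
  qed
qed

end

section \<open>Reversible kernels\<close>

locale reversible_kernel = markov_kernel +
  assumes symmetric: "\<And>f g. f \<in> bounded_fun w \<Longrightarrow> g \<in> bounded_fun w \<Longrightarrow>
    (\<integral>z. f z * kop P g z \<partial>w) = (\<integral>z. kop P f z * g z \<partial>w)"
begin

lemma invariant: assumes f: "f \<in> bounded_fun w" shows "(\<integral>z. kop P f z \<partial>w) = (\<integral>z. f z \<partial>w)"
proof -
  have "(\<integral>z. kop P f z \<partial>w) = (\<integral>z. kop P (\<lambda>_. 1) z * f z \<partial>w)"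
    using symmetric[OF bounded_fun_const f, of 1] by simp
  also have "\<dots> = (\<integral>z. f z \<partial>w)"
    by (rule Bochner_Integration.integral_cong) (auto simp: kop_const)
  finally show ?thesis .
qed

lemma integral_kop_pow: "f \<in> bounded_fun w \<Longrightarrow> (\<integral>z. (kop P ^^ n) f z \<partial>w) = (\<integral>z. f z \<partial>w)"
  by (induction n) (auto simp: invariant kop_pow_bounded)

lemma contraction: assumes f: "f \<in> bounded_fun w" shows "sqint w (kop P f) \<le> sqint w f"
proof -
  have "sqint w (kop P f) \<le> (\<integral>z. kop P (\<lambda>u. (f u)\<^sup>2) z \<partial>w)"
    unfolding sqint_def using f
    by (intro integral_mono integrable_bounded_fun bounded_fun_power2 kop_bounded kop_square_le)
  also have "\<dots> = sqint w f"
    unfolding sqint_def by (rule invariant[OF bounded_fun_power2[OF f]])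
  finally show ?thesis .
qed

lemma admissible_rate_1: "admissible_rate w P 1"
proof (rule decay_imp_admissible[where c=1])
  fix n f assume f: "f \<in> bounded_fun w"
  have "sqint w ((kop P ^^ n) f) \<le> sqint w f"
  proof (induction n)
    case (Suc n)
    then show ?case using contraction[OF kop_pow_bounded[OF f, of n]] by simp
  qed simp
  then show "sqint w ((kop P ^^ n) f) \<le> (1 * 1 ^ n)\<^sup>2 * sqint w f" by simp
qed auto

lemma symmetric_pow:
  assumes "f \<in> bounded_fun w" "g \<in> bounded_fun w"
  shows "(\<integral>z. f z * (kop P ^^ n) g z \<partial>w) = (\<integral>z. (kop P ^^ n) f z * g z \<partial>w)"
  using assms(1)
proof (induction n arbitrary: f)
  case (Suc n)
  have "(\<integral>z. f z * (kop P ^^ Suc n) g z \<partial>w) = (\<integral>z. kop P f z * (kop P ^^ n) g z \<partial>w)"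
    using symmetric[OF Suc.prems kop_pow_bounded[OF assms(2)]] by simp
  also have "\<dots> = (\<integral>z. (kop P ^^ n) (kop P f) z * g z \<partial>w)"
    by (rule Suc.IH[OF kop_bounded[OF Suc.prems]])
  finally show ?case by (simp add: funpow_swap1)
qed simp

text \<open>
Restricting the exponents to powers of two makes Cauchy-Schwarz alone sufficient:
\<open>\<langle>f, T\<^sup>n f\<rangle>\<^sup>2 \<le> \<parallel>f\<parallel>\<^sup>2 \<parallel>T\<^sup>n f\<parallel>\<^sup>2 = \<parallel>f\<parallel>\<^sup>2 \<langle>f, T\<^sup>2\<^sup>n f\<rangle>\<close> by self-adjointness. This sparse set of exponents is
enough to detect an exponential rate.
\<close>
lemma rayleigh_power_le:
  assumes f: "f \<in> bounded_fun w" and pos: "0 < sqint w f"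
    and a: "a * sqint w f = (\<integral>z. f z * kop P f z \<partial>w)" "0 \<le> a"
  shows "a ^ (2 ^ k) * sqint w f \<le> (\<integral>z. f z * (kop P ^^ (2 ^ k)) f z \<partial>w)"
proof (induction k)
  case 0
  then show ?case using a by simp
next
  case (Suc k)
  let ?n = "2 ^ k :: nat" and ?s = "sqint w f"
  have fn: "(kop P ^^ ?n) f \<in> bounded_fun w" by (rule kop_pow_bounded[OF f])
  have "(a ^ ?n * ?s)\<^sup>2 \<le> (\<integral>z. f z * (kop P ^^ ?n) f z \<partial>w)\<^sup>2"
    using Suc a(2) pos by (intro power_mono) auto
  also have "\<dots> \<le> ?s * sqint w ((kop P ^^ ?n) f)"
    by (rule Cauchy_Schwarz_bounded[OF f fn])
  also have "sqint w ((kop P ^^ ?n) f) = (\<integral>z. f z * (kop P ^^ ?n) ((kop P ^^ ?n) f) z \<partial>w)"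
    unfolding symmetric_pow[OF f fn] sqint_def by (simp add: power2_eq_square)
  also have "(kop P ^^ ?n) ((kop P ^^ ?n) f) = (kop P ^^ (2 ^ Suc k)) f"
    by (simp add: funpow_add mult_2)
  finally have "?s * (a ^ (2 ^ Suc k) * ?s) \<le> ?s * (\<integral>z. f z * (kop P ^^ (2 ^ Suc k)) f z \<partial>w)"
    by (simp add: power2_eq_square power_add mult_2 mult_ac)
  then show ?case using pos by simp
qed

text \<open>
The law with density \<open>1 + f / M\<close> is tested against \<open>f / \<parallel>f\<parallel>\<close>. The constant 1 contributes the
mean of \<open>f\<close>, which is 0, and what remains is a multiple of \<open>\<langle>f, T\<^sup>n f\<rangle>\<close>, bounded from below by
a power of the Rayleigh quotient.
\<close>
lemma admissible_imp_rayleigh_le: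
  assumes adm: "admissible_rate w P \<rho>" and \<rho>: "0 \<le> \<rho>"
    and f: "f \<in> bounded_fun w" and f0: "(\<integral>z. f z \<partial>w) = 0"
  shows "(\<integral>z. f z * kop P f z \<partial>w) \<le> \<rho> * sqint w f"
proof (cases "sqint w f = 0")
  case True
  have "(\<integral>z. f z * kop P f z \<partial>w)\<^sup>2 \<le> 0"
    using Cauchy_Schwarz_bounded[OF f kop_bounded[OF f]] True by simp
  then show ?thesis using True by simp
next
  case False
  let ?s = "sqint w f"
  have s: "0 < ?s" using False sqint_nonneg[of w f] by linarith
  define a where "a = (\<integral>z. f z * kop P f z \<partial>w) / ?s"
  have "a \<le> \<rho>"
  proof (rule ccontr)
    assume "\<not> a \<le> \<rho>"
    then have a: "\<rho> < a" "0 < a" using \<rho> by auto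
    obtain M where M: "\<And>z. z \<in> space w \<Longrightarrow> \<bar>f z\<bar> \<le> M" "0 < M"
    proof -
      obtain c where "\<And>z. z \<in> space w \<Longrightarrow> \<bar>f z\<bar> \<le> c" "0 \<le> c" using f by (metis bounded_funE)
      then show thesis by (intro that[of "c + 1"]) force+
    qed
    define h where "h z = 1 + (1 / M) * f z" for z
    define \<mu> where "\<mu> = density w (\<lambda>z. ennreal (h z))"
    have h: "h \<in> bounded_fun w" unfolding h_def by (intro bounded_fun_intros f)
    have h0: "0 \<le> h z" if "z \<in> space w" for z
      using M(1)[OF that] M(2) by (simp add: h_def field_simps abs_le_iff)
    have \<mu>: "\<mu> \<in> L2_star w"
      unfolding \<mu>_def
      by (rule L2_star_bounded_density[OF h h0])
        (use integrable_bounded_fun[OF f] in \<open>simp_all add: h_def f0 prob_space\<close>)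
    then have \<mu>': "\<mu> \<in> space (prob_algebra w)" by (simp add: L2_star_def space_prob_algebra)
    obtain C where C: "\<And>n. 1 \<le> n \<Longrightarrow> L2_dist w (bind \<mu> (kernel_pow w P n)) w < ennreal (C * \<rho> ^ n)"
      using adm \<mu> unfolding admissible_rate_def by blast
    define F where "F z = (1 / sqrt ?s) * f z" for z
    have F: "F \<in> bounded_fun w" unfolding F_def by (intro bounded_fun_intros f)
    have F0: "(\<integral>z. F z \<partial>w) = 0" by (simp add: F_def f0)
    have F1: "F \<in> {f \<in> L2_0 w. L2_norm w f = 1}"
      using F F0 s integrable_bounded_fun[OF bounded_fun_power2[OF F]]
      by (auto simp: L2_0_def L2_def L2_norm_def bounded_fun_measurable)
        (simp add: F_def power_mult_distrib power_divide flip: sqint_def)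
    have lower: "\<bar>\<integral>z. F z \<partial>bind \<mu> (kernel_pow w P n)\<bar> = \<bar>\<integral>z. f z * (kop P ^^ n) f z \<partial>w\<bar> / (M * sqrt ?s)" for n
    proof -
      have Pn: "(kop P ^^ n) F \<in> bounded_fun w" by (rule kop_pow_bounded[OF F])
      have "(\<integral>z. F z \<partial>bind \<mu> (kernel_pow w P n)) = (\<integral>z. (kop P ^^ n) F z \<partial>\<mu>)"
        by (rule integral_bind_kernel_pow[OF F \<mu>'])
      also have "\<dots> = (\<integral>z. h z * (kop P ^^ n) F z \<partial>w)"
        unfolding \<mu>_def using h h0 Pn
        by (subst integral_real_density) (auto simp: bounded_fun_measurable)
      also have "\<dots> = (\<integral>z. (kop P ^^ n) F z + (1 / M) * (f z * (kop P ^^ n) F z) \<partial>w)"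
        by (simp add: h_def algebra_simps)
      also have "\<dots> = (\<integral>z. (kop P ^^ n) F z \<partial>w) + (1 / M) * (\<integral>z. f z * (kop P ^^ n) F z \<partial>w)"
        using integrable_bounded_fun[OF Pn] integrable_bounded_fun[OF bounded_fun_times[OF f Pn]] by simp
      also have "(\<integral>z. (kop P ^^ n) F z \<partial>w) = 0"
        using integral_kop_pow[OF F] F0 by simp
      also have "(\<integral>z. f z * (kop P ^^ n) F z \<partial>w) = (1 / sqrt ?s) * (\<integral>z. f z * (kop P ^^ n) f z \<partial>w)"
        unfolding symmetric_pow[OF f F] symmetric_pow[OF f f] by (simp add: F_def mult.left_commute)
      finally show ?thesis using M(2) by (simp add: abs_mult)
    qed
    have upper: "a ^ (2 ^ k) * ?s / (M * sqrt ?s) < C * \<rho> ^ (2 ^ k)" for k :: nat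
    proof -
      let ?n = "2 ^ k :: nat"
      have "a ^ ?n * ?s \<le> \<bar>\<integral>z. f z * (kop P ^^ ?n) f z \<partial>w\<bar>"
        using rayleigh_power_le[OF f s, of a k] a s by (simp add: a_def)
      then have "a ^ ?n * ?s / (M * sqrt ?s) \<le> \<bar>\<integral>z. F z \<partial>bind \<mu> (kernel_pow w P ?n)\<bar>"
        unfolding lower using M(2) s by (intro divide_right_mono) auto
      moreover have "ennreal \<bar>\<integral>z. F z \<partial>bind \<mu> (kernel_pow w P ?n)\<bar> < ennreal (C * \<rho> ^ ?n)"
      proof -
        have "ennreal \<bar>(\<integral>z. F z \<partial>bind \<mu> (kernel_pow w P ?n)) - (\<integral>z. F z \<partial>w)\<bar>
            \<le> L2_dist w (bind \<mu> (kernel_pow w P ?n)) w"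
          unfolding L2_dist_def by (rule SUP_upper[OF F1])
        with C[of ?n] show ?thesis by (simp add: F0 order_le_less_trans)
      qed
      ultimately show ?thesis by (simp add: ennreal_less_iff)
    qed
    define b where "b = ?s / (M * sqrt ?s)"
    have b: "0 < b" using M(2) s by (simp add: b_def)
    show False
    proof (cases "\<rho> = 0")
      case True
      then show False using upper[of 0] mult_pos_pos[OF a(2) b] by (simp add: b_def)
    next
      case False
      then have \<rho>0: "0 < \<rho>" using \<rho> by simp
      have "1 < a / \<rho>" using a(1) \<rho>0 by simp
      \<comment> \<open>An exponent \<open>k\<close> that beats the constant is replaced by \<open>2 ^ k \<ge> k\<close>, where the lower bound is available.\<close>
      then obtain k where k: "C / b < (a / \<rho>) ^ k" using real_arch_pow by blast
      also have "(a / \<rho>) ^ k \<le> (a / \<rho>) ^ (2 ^ k)"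
        using \<open>1 < a / \<rho>\<close> by (intro power_increasing) (auto simp: less_exp less_imp_le)
      finally have "C * \<rho> ^ (2 ^ k) < a ^ (2 ^ k) * b"
        using b \<rho>0 by (simp add: field_simps)
      with upper[of k] show False by (simp add: b_def)
    qed
  qed
  then show ?thesis using s by (simp add: a_def field_simps)
qed

end

section \<open>Averaging kernels\<close>

text \<open>
The averaging identity (also called Reynolds identity) characterises conditional expectations among the
mean-preserving Markov operators. It is used in place of a sub-\<open>\<sigma>\<close>-algebra because it can be checked
pointwise for the coordinate updates, also where singletons are not measurable.
\<close>
locale averaging_kernel = markov_kernel +
  assumes preserves: "\<And>f. f \<in> bounded_fun w \<Longrightarrow> (\<integral>z. kop P f z \<partial>w) = (\<integral>z. f z \<partial>w)"
    and averaging: "\<And>f g z. f \<in> bounded_fun w \<Longrightarrow> g \<in> bounded_fun w \<Longrightarrow> z \<in> space w \<Longrightarrow>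
      kop P (\<lambda>u. f u * kop P g u) z = kop P f z * kop P g z"
begin

lemma integral_mult_kop:
  assumes "f \<in> bounded_fun w" "g \<in> bounded_fun w"
  shows "(\<integral>z. f z * kop P g z \<partial>w) = (\<integral>z. kop P f z * kop P g z \<partial>w)"
proof -
  have "(\<integral>z. f z * kop P g z \<partial>w) = (\<integral>z. kop P (\<lambda>u. f u * kop P g u) z \<partial>w)"
    using assms by (intro preserves[symmetric] bounded_fun_times kop_bounded)
  also have "\<dots> = (\<integral>z. kop P f z * kop P g z \<partial>w)"
    using assms by (intro Bochner_Integration.integral_cong) (auto simp: averaging)
  finally show ?thesis .
qed

sublocale reversible_kernel
proof
  fix f g assume f: "f \<in> bounded_fun w" and g: "g \<in> bounded_fun w"
  show "(\<integral>z. f z * kop P g z \<partial>w) = (\<integral>z. kop P f z * g z \<partial>w)"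
    using integral_mult_kop[OF f g] integral_mult_kop[OF g f] by (simp add: mult.commute)
qed

lemma idempotent: 
  assumes g: "g \<in> bounded_fun w" and z: "z \<in> space w"
  shows "kop P (kop P g) z = kop P g z"
  using averaging[OF bounded_fun_const g z, of 1] by (simp add: kop_const[OF z])

lemma integral_mult_kop_self:
  "f \<in> bounded_fun w \<Longrightarrow> (\<integral>z. f z * kop P f z \<partial>w) = sqint w (kop P f)"
  by (simp add: integral_mult_kop sqint_def power2_eq_square)

end

locale two_averaging_kernels = K1: averaging_kernel w K1 + K2: averaging_kernel w K2
  for w :: "'c measure" and K1 K2
begin

lemma flip: "two_averaging_kernels w K2 K1"
  by unfold_locales

text \<open>
The least such factor is the squared cosine of the angle between the ranges of the two projections,
restricted to mean-zero functions.
\<close>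
definition contracts :: "real \<Rightarrow> bool" where
  "contracts g \<longleftrightarrow> (\<forall>f\<in>bounded_fun w. (\<integral>z. f z \<partial>w) = 0 \<longrightarrow> (\<forall>z\<in>space w. kop K2 f z = f z) \<longrightarrow>
     sqint w (kop K1 f) \<le> g * sqint w f)"

lemma contracts_kop:
  assumes "contracts g" and f: "f \<in> bounded_fun w" and f0: "(\<integral>z. f z \<partial>w) = 0"
  shows "sqint w (kop K1 (kop K2 f)) \<le> g * sqint w (kop K2 f)"
  using assms K2.idempotent[OF f] K2.kop_bounded[OF f] K2.preserves[OF f]
  unfolding contracts_def by auto

text \<open>
The two restricted projections are adjoint to each other, so they have the same norm: for \<open>T1 h = h\<close>
the number \<open>a = \<parallel>T2 h\<parallel>\<^sup>2\<close> equals \<open>\<langle>h, T1 T2 h\<rangle>\<close>, whence \<open>a\<^sup>2 \<le> \<parallel>h\<parallel>\<^sup>2 g a\<close>.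
\<close>
lemma contracts_flip:
  assumes g: "0 \<le> g" and c: "contracts g"
  shows "two_averaging_kernels.contracts w K2 K1 g"
  unfolding two_averaging_kernels.contracts_def[OF flip]
proof (intro ballI impI)
  fix h assume h: "h \<in> bounded_fun w" and h0: "(\<integral>z. h z \<partial>w) = 0" and inv: "\<forall>z\<in>space w. kop K1 h z = h z"
  let ?a = "sqint w (kop K2 h)"
  note b = K2.kop_bounded[OF h] K1.kop_bounded[OF K2.kop_bounded[OF h]]
  have "?a = (\<integral>z. h z * kop K2 h z \<partial>w)"
    by (simp add: K2.integral_mult_kop_self[OF h])
  also have "\<dots> = (\<integral>z. kop K1 h z * kop K2 h z \<partial>w)"
    using inv by (intro Bochner_Integration.integral_cong) auto
  also have "\<dots> = (\<integral>z. h z * kop K1 (kop K2 h) z \<partial>w)"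
    by (rule K1.symmetric[OF h b(1), symmetric])
  finally have "?a\<^sup>2 \<le> sqint w h * sqint w (kop K1 (kop K2 h))"
    using K1.Cauchy_Schwarz_bounded[OF h b(2)] by simp
  also have "\<dots> \<le> sqint w h * (g * ?a)"
    by (rule mult_left_mono[OF contracts_kop[OF c h h0]]) simp
  finally have *: "?a * ?a \<le> (g * sqint w h) * ?a"
    by (simp add: power2_eq_square mult_ac)
  show "?a \<le> g * sqint w h"
  proof (cases "?a = 0")
    case False
    then have "0 < ?a" using sqint_nonneg[of w "kop K2 h"] by linarith
    with * show ?thesis by simp
  qed (use g in simp)
qed

lemma contracts_1: "contracts 1"
  by (simp add: contracts_def K1.contraction)

end

locale composed_averaging_kernels = two_averaging_kernels w K1 K2 + D: markov_kernel w D
  for w :: "'c measure" and K1 K2 D +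
  assumes composed: "\<And>f z. f \<in> bounded_fun w \<Longrightarrow> z \<in> space w \<Longrightarrow> kop D f z = kop K2 (kop K1 f) z"
begin

text \<open>
Each half step of a sweep starts in the range of the other projection and contracts by \<open>g\<close>, so a
sweep contracts the squared norm by \<open>g\<^sup>2\<close>. Only the first half step starts from an arbitrary function;
the first sweep is therefore estimated by 1.
\<close>
lemma composed_decay:
  assumes g: "0 \<le> g" and c: "contracts g" 
    and f: "f \<in> bounded_fun w" and f0: "(\<integral>z. f z \<partial>w) = 0"
  shows "sqint w ((kop D ^^ Suc n) f) \<le> (g ^ n)\<^sup>2 * sqint w f"
proof (induction n)
  case 0
  have "sqint w (kop D f) = sqint w (kop K2 (kop K1 f))"
    by (rule sqint_cong) (rule composed[OF f])
  also have "\<dots> \<le> sqint w (kop K1 f)" by (rule K2.contraction[OF K1.kop_bounded[OF f]])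
  also have "\<dots> \<le> sqint w f" by (rule K1.contraction[OF f])
  finally show ?case by simp
next
  case (Suc n)
  interpret F: two_averaging_kernels w K2 K1 by (rule flip)
  let ?u = "\<lambda>n. (kop D ^^ n) f"
  have u: "?u n \<in> bounded_fun w" for n by (rule D.kop_pow_bounded[OF f])
  note K1u = K1.kop_bounded[OF u]
  have step: "?u (Suc n) z = kop K2 (kop K1 (?u n)) z" if "z \<in> space w" for n z
    using composed[OF u that] by simp
  have u0: "(\<integral>z. ?u n z \<partial>w) = 0" for n
  proof (induction n)
    case (Suc n)
    have "(\<integral>z. ?u (Suc n) z \<partial>w) = (\<integral>z. kop K2 (kop K1 (?u n)) z \<partial>w)"
      by (rule Bochner_Integration.integral_cong) (simp_all only: step)
    then show ?case using K2.preserves[OF K1u] K1.preserves[OF u] Suc by simp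
  qed (simp add: f0)
  have K1u0: "(\<integral>z. kop K1 (?u n) z \<partial>w) = 0" for n
    using K1.preserves[OF u] u0 by simp
  have "sqint w (kop K1 (?u (Suc n))) = sqint w (kop K1 (kop K2 (kop K1 (?u n))))"
    by (intro sqint_cong K1.kop_cong step)
  also have "\<dots> \<le> g * sqint w (kop K2 (kop K1 (?u n)))"
    by (rule contracts_kop[OF c K1u K1u0])
  also have "sqint w (kop K2 (kop K1 (?u n))) = sqint w (?u (Suc n))"
    by (rule sqint_cong) (rule step[symmetric])
  finally have half_step: "sqint w (kop K1 (?u (Suc n))) \<le> g * sqint w (?u (Suc n))" .
  have "sqint w (?u (Suc (Suc n))) = sqint w (kop K2 (kop K1 (?u (Suc n))))"
    by (rule sqint_cong) (rule step)
  also have "\<dots> \<le> g * sqint w (kop K1 (?u (Suc n)))"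
    by (rule F.contracts_kop[OF contracts_flip[OF g c] u u0])
  also have "\<dots> \<le> g * (g * sqint w (?u (Suc n)))"
    by (rule mult_left_mono[OF half_step g])
  also have "\<dots> \<le> g * (g * ((g ^ n)\<^sup>2 * sqint w f))"
    by (intro mult_left_mono Suc.IH g)
  finally show ?case by (simp add: power2_eq_square mult_ac)
qed

lemma admissible_composed:
  assumes g: "0 \<le> g" and c: "contracts g" and \<rho>: "g \<le> \<rho>" "0 < \<rho>"
  shows "admissible_rate w D \<rho>"
proof (rule D.decay_imp_admissible[where c="1 / \<rho>"])
  fix n :: nat and f assume n: "1 \<le> n" and f: "f \<in> bounded_fun w" "(\<integral>z. f z \<partial>w) = 0"
  obtain m where m: "n = Suc m" using n by (cases n) auto
  have "sqint w ((kop D ^^ n) f) \<le> (g ^ m)\<^sup>2 * sqint w f"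
    unfolding m by (rule composed_decay[OF g c f])
  also have "\<dots> \<le> (\<rho> ^ m)\<^sup>2 * sqint w f"
    using g \<rho> by (intro mult_right_mono power_mono) auto
  also have "\<rho> ^ m = 1 / \<rho> * \<rho> ^ n" using \<rho> by (simp add: m)
  finally show "sqint w ((kop D ^^ n) f) \<le> (1 / \<rho> * \<rho> ^ n)\<^sup>2 * sqint w f" .
qed (use \<rho> in auto)

lemma L2_rate_composed_le:
  assumes g: "0 \<le> g" "g \<le> 1" and c: "contracts g"
  shows "L2_rate w D \<le> g"
proof (rule dense_ge)
  fix \<rho> :: real assume \<rho>: "g < \<rho>"
  have "L2_rate w D \<le> min \<rho> 1" if "min \<rho> 1 > 0"
    using g \<rho> that by (intro L2_rate_le admissible_composed[OF g(1) c]) auto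
  then show "L2_rate w D \<le> \<rho>" using g \<rho> by auto
qed

lemma L2_rate_composed_nonneg: "0 \<le> L2_rate w D"
  unfolding L2_rate_alt using admissible_composed[OF _ contracts_1, of 1]
  by (intro cInf_greatest) auto

end

section \<open>Random scan\<close>

text \<open>
The left-hand side is the contraction factor \<open>g\<close> solving \<open>\<rho> = s g + (1 - s)\<close>. The claim is then
the weighted inequality between the arithmetic and the geometric mean of \<open>g\<close> and 1.
\<close>
lemma tangent_rate_le_powr:
  fixes \<rho> s :: real
  assumes s: "0 < s" "s < 1" and \<rho>: "0 \<le> \<rho>"
  shows "max 0 ((\<rho> - (1 - s)) / s) \<le> \<rho> powr (1 / s)"
proof (cases "\<rho> \<le> 1 - s")
  case True
  then have "(\<rho> - (1 - s)) / s \<le> 0" using s by (simp add: divide_le_0_iff)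
  then show ?thesis by simp
next
  case False
  define g where "g = (\<rho> - (1 - s)) / s"
  have g: "0 < g" "\<rho> = s * g + (1 - s)" using False s by (auto simp: g_def)
  have "g powr s * 1 powr (1 - s) \<le> s * g + (1 - s) * 1"
    using s g by (intro Youngs_inequality_0) auto
  then have "(g powr s) powr (1 / s) \<le> \<rho> powr (1 / s)"
    using s g(2) by (intro powr_mono2) auto
  then have "g \<le> \<rho> powr (1 / s)"
    using s g(1) by (simp add: powr_powr)
  then show ?thesis by (simp add: g_def)
qed

locale mixed_averaging_kernels = two_averaging_kernels w K1 K2 + R: markov_kernel w R
  for w :: "'c measure" and K1 K2 R +
  fixes r :: real
  assumes r: "0 < r" "r < 1"
    and mixed: "\<And>f z. f \<in> bounded_fun w \<Longrightarrow> z \<in> space w \<Longrightarrow> kop R f z = r * kop K1 f z + (1 - r) * kop K2 f z"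
begin

lemma integral_mult_mixed:
  assumes f: "f \<in> bounded_fun w" and g: "g \<in> bounded_fun w"
  shows "(\<integral>z. g z * kop R f z \<partial>w) = r * (\<integral>z. g z * kop K1 f z \<partial>w) + (1 - r) * (\<integral>z. g z * kop K2 f z \<partial>w)"
proof -
  have "(\<integral>z. g z * kop R f z \<partial>w) = (\<integral>z. r * (g z * kop K1 f z) + (1 - r) * (g z * kop K2 f z) \<partial>w)"
    by (intro Bochner_Integration.integral_cong) (auto simp: mixed[OF f] algebra_simps)
  also have "\<dots> = r * (\<integral>z. g z * kop K1 f z \<partial>w) + (1 - r) * (\<integral>z. g z * kop K2 f z \<partial>w)"
    using K1.integrable_bounded_fun[OF bounded_fun_times[OF g K1.kop_bounded[OF f]]]
      K1.integrable_bounded_fun[OF bounded_fun_times[OF g K2.kop_bounded[OF f]]] by simp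
  finally show ?thesis .
qed

sublocale R: reversible_kernel w R
proof
  fix f g assume f: "f \<in> bounded_fun w" and g: "g \<in> bounded_fun w"
  have "(\<integral>z. f z * kop R g z \<partial>w) = (\<integral>z. g z * kop R f z \<partial>w)"
    unfolding integral_mult_mixed[OF f g] integral_mult_mixed[OF g f]
    using K1.symmetric[OF f g] K2.symmetric[OF f g] by (simp add: mult.commute)
  then show "(\<integral>z. f z * kop R g z \<partial>w) = (\<integral>z. kop R f z * g z \<partial>w)" by (simp add: mult.commute)
qed

text \<open>
A function invariant under \<open>K2\<close> is changed by the mixture only when \<open>K1\<close> is selected. Its Rayleigh
quotient is therefore an affine function of \<open>\<parallel>T1 f\<parallel>\<^sup>2 / \<parallel>f\<parallel>\<^sup>2\<close>, and the admissible rate bounds it. The cut-off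
at 0 covers the degenerate case in which all such \<open>f\<close> vanish almost everywhere.
\<close>
lemma admissible_imp_contracts:
  assumes adm: "admissible_rate w R \<rho>" and \<rho>: "0 \<le> \<rho>"
  shows "contracts (max 0 ((\<rho> - (1 - r)) / r))"
  unfolding contracts_def
proof (intro ballI impI)
  fix f assume f: "f \<in> bounded_fun w" and f0: "(\<integral>z. f z \<partial>w) = 0" and inv: "\<forall>z\<in>space w. kop K2 f z = f z"
  have "r * sqint w (kop K1 f) + (1 - r) * sqint w f
      = r * (\<integral>z. f z * kop K1 f z \<partial>w) + (1 - r) * (\<integral>z. f z * kop K2 f z \<partial>w)"
    unfolding K1.integral_mult_kop_self[OF f] K2.integral_mult_kop_self[OF f]
    using sqint_cong[of w "kop K2 f" f] inv by simp
  also have "\<dots> \<le> \<rho> * sqint w f"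
    unfolding integral_mult_mixed[OF f f, symmetric]
    by (rule R.admissible_imp_rayleigh_le[OF adm \<rho> f f0])
  finally have "sqint w (kop K1 f) \<le> (\<rho> - (1 - r)) / r * sqint w f"
    using r by (simp add: field_simps)
  also have "\<dots> \<le> max 0 ((\<rho> - (1 - r)) / r) * sqint w f"
    by (intro mult_right_mono) auto
  finally show "sqint w (kop K1 f) \<le> max 0 ((\<rho> - (1 - r)) / r) * sqint w f" .
qed

lemma flip_mixed: "mixed_averaging_kernels w K2 K1 R (1 - r)"
proof -
  interpret F: two_averaging_kernels w K2 K1 by (rule flip)
  show ?thesis by unfold_locales (use r in \<open>auto simp: mixed\<close>)
qed

end

locale composed_and_mixed_kernels = composed_averaging_kernels w K1 K2 D + mixed_averaging_kernels w K1 K2 R r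
  for w :: "'c measure" and K1 K2 D R r
begin

lemma L2_rate_composed_le_powr:
  assumes adm: "admissible_rate w R \<rho>" and \<rho>: "0 \<le> \<rho>" "\<rho> \<le> 1"
  shows "L2_rate w D \<le> \<rho> powr (1 / r)" and "L2_rate w D \<le> \<rho> powr (1 / (1 - r))"
proof -
  interpret F: mixed_averaging_kernels w K2 K1 R "1 - r" by (rule flip_mixed)
  have le1: "max 0 ((\<rho> - (1 - s)) / s) \<le> 1" if "0 < s" for s :: real
    using \<rho> that by (simp add: field_simps)
  have "L2_rate w D \<le> max 0 ((\<rho> - (1 - r)) / r)"
    by (rule L2_rate_composed_le[OF _ le1 admissible_imp_contracts[OF adm \<rho>(1)]]) (use r in auto)
  also have "\<dots> \<le> \<rho> powr (1 / r)" by (rule tangent_rate_le_powr[OF r \<rho>(1)])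
  finally show "L2_rate w D \<le> \<rho> powr (1 / r)" .
  have "contracts (max 0 ((\<rho> - (1 - (1 - r))) / (1 - r)))"
    by (rule F.contracts_flip[OF _ F.admissible_imp_contracts[OF adm \<rho>(1)]]) simp
  from L2_rate_composed_le[OF _ le1 this]
  have "L2_rate w D \<le> max 0 ((\<rho> - (1 - (1 - r))) / (1 - r))"
    using r by simp
  also have "\<dots> \<le> \<rho> powr (1 / (1 - r))" by (rule tangent_rate_le_powr[OF F.r \<rho>(1)])
  finally show "L2_rate w D \<le> \<rho> powr (1 / (1 - r))" .
qed

text \<open>
The estimate is first taken to the power \<open>kD / kR\<close>: in this form the right-hand side is \<open>\<rho>\<close> itself, and
the infimum over all admissible \<open>\<rho>\<close> can be formed without continuity of powers. The constant rate 1 is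
admissible by contractivity, so the infimum runs over a nonempty set.
\<close>
lemma L2_rate_powr_le:
  assumes k: "0 < kD" "0 < kR" and q: "kR / kD \<le> max (1 / r) (1 / (1 - r))"
  shows "L2_rate w D powr kD \<le> L2_rate w R powr kR"
proof -
  note nonneg = L2_rate_composed_nonneg
  have "L2_rate w D powr (kD / kR) \<le> L2_rate w R"
    unfolding L2_rate_alt[of w R]
  proof (rule cInf_greatest)
    show "{\<rho> \<in> {0..1}. admissible_rate w R \<rho>} \<noteq> {}" using R.admissible_rate_1 by auto
    fix \<rho> assume "\<rho> \<in> {\<rho> \<in> {0..1}. admissible_rate w R \<rho>}"
    then have \<rho>: "0 \<le> \<rho>" "\<rho> \<le> 1" and adm: "admissible_rate w R \<rho>" by auto
    have "L2_rate w D \<le> \<rho> powr max (1 / r) (1 / (1 - r))"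
      using L2_rate_composed_le_powr[OF adm \<rho>] by (simp add: max_def)
    also have "\<dots> \<le> \<rho> powr (kR / kD)"
      using \<rho> q by (intro powr_mono') auto
    finally have "L2_rate w D powr (kD / kR) \<le> (\<rho> powr (kR / kD)) powr (kD / kR)"
      using k nonneg by (intro powr_mono2) auto
    then show "L2_rate w D powr (kD / kR) \<le> \<rho>"
      using k \<rho> by (simp add: powr_powr)
  qed
  then have "(L2_rate w D powr (kD / kR)) powr kR \<le> L2_rate w R powr kR"
    using k by (intro powr_mono2) auto
  then show ?thesis using k by (simp add: powr_powr)
qed

end

section \<open>Gibbs kernels\<close>

lemma prob_algebra_cong: "sets M = sets N \<Longrightarrow> prob_algebra M = prob_algebra N"
  by (simp add: prob_algebra_def cong: subprob_algebra_cong)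

locale joint_law = prob_space J
  for X :: "'a measure" and Y :: "'b measure" and J :: "('a \<times> 'b) measure"
    and KXY :: "'b \<Rightarrow> 'a measure" and KYX :: "'a \<Rightarrow> 'b measure" +
  assumes sets_J: "sets J = sets (X \<Otimes>\<^sub>M Y)"
    and XY: "full_conditional_XY X Y J KXY"
    and YX: "full_conditional_YX X Y J KYX"
begin

text \<open>
The coordinate updates are kernels on the product space. As such they are averaging kernels; the
deterministic scan is their composition, with \<open>update_Y\<close> performed first, and the random scan is their
mixture.
\<close>
definition update_X :: "'a \<times> 'b \<Rightarrow> ('a \<times> 'b) measure" where
  "update_X z = KXY (snd z) \<Otimes>\<^sub>M return Y (snd z)"

definition update_Y :: "'a \<times> 'b \<Rightarrow> ('a \<times> 'b) measure" where
  "update_Y z = return X (fst z) \<Otimes>\<^sub>M KYX (fst z)"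

lemma KXY [measurable]: "KXY \<in> Y \<rightarrow>\<^sub>M prob_algebra X"
  using XY by (simp add: full_conditional_XY_def)

lemma KYX [measurable]: "KYX \<in> X \<rightarrow>\<^sub>M prob_algebra Y"
  using YX by (simp add: full_conditional_YX_def)

lemma space_J: "space J = space X \<times> space Y"
  using sets_eq_imp_space_eq[OF sets_J] by (simp add: space_pair_measure)

lemma bounded_fun_J: "bounded_fun J = bounded_fun (X \<Otimes>\<^sub>M Y)"
  by (rule bounded_fun_sets_cong[OF sets_J])

lemma measurable_J: "measurable J (prob_algebra J) = measurable (X \<Otimes>\<^sub>M Y) (prob_algebra (X \<Otimes>\<^sub>M Y))"
  using prob_algebra_cong[OF sets_J] by (simp add: measurable_cong_sets[OF sets_J refl])

sublocale K1: markov_kernel J update_X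
  by unfold_locales (unfold measurable_J update_X_def[abs_def], measurable)

sublocale K2: markov_kernel J update_Y
  by unfold_locales (unfold measurable_J update_Y_def[abs_def], measurable)

lemma conditional_X: "y \<in> space Y \<Longrightarrow> prob_space (KXY y) \<and> sets (KXY y) = sets X"
  using measurable_space[OF KXY] by (simp add: space_prob_algebra)

lemma conditional_Y: "x \<in> space X \<Longrightarrow> prob_space (KYX x) \<and> sets (KYX x) = sets Y"
  using measurable_space[OF KYX] by (simp add: space_prob_algebra)

lemma kop_update_X:
  assumes f: "f \<in> bounded_fun J" and z: "(x, y) \<in> space J"
  shows "kop update_X f (x, y) = (\<integral>u. f (u, y) \<partial>KXY y)"
proof -
  have xy: "x \<in> space X" "y \<in> space Y" using z by (auto simp: space_J)
  interpret A: prob_space "KXY y" using conditional_X xy by blast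
  interpret B: prob_space "return Y y" using xy by (intro prob_space_return)
  interpret AB: pair_prob_space "KXY y" "return Y y" ..
  have sets_X: "sets (KXY y) = sets X" using conditional_X xy by blast
  then have space_X: "space (KXY y) = space X" by (rule sets_eq_imp_space_eq)
  have [measurable]: "f \<in> borel_measurable (X \<Otimes>\<^sub>M Y)"
    using f bounded_fun_measurable by (simp add: bounded_fun_J)
  have "sets (KXY y \<Otimes>\<^sub>M return Y y) = sets J"
    unfolding sets_J by (intro sets_pair_measure_cong) (simp_all add: sets_X)
  then have "f \<in> bounded_fun (KXY y \<Otimes>\<^sub>M return Y y)"
    using f bounded_fun_sets_cong by blast
  then have "integrable (KXY y \<Otimes>\<^sub>M return Y y) f"
    by (rule AB.P.integrable_bounded_fun)
  from AB.integral_fst'[OF this]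
  have "kop update_X f (x, y) = (\<integral>u. (\<integral>v. f (u, v) \<partial>return Y y) \<partial>KXY y)"
    by (simp add: kop_def update_X_def)
  also have "\<dots> = (\<integral>u. f (u, y) \<partial>KXY y)"
    using xy by (intro Bochner_Integration.integral_cong) (auto simp: integral_return space_X)
  finally show ?thesis .
qed

lemma kop_update_Y:
  assumes f: "f \<in> bounded_fun J" and z: "(x, y) \<in> space J"
  shows "kop update_Y f (x, y) = (\<integral>v. f (x, v) \<partial>KYX x)"
proof -
  have xy: "x \<in> space X" "y \<in> space Y" using z by (auto simp: space_J)
  interpret A: prob_space "KYX x" using conditional_Y xy by blast
  interpret B: prob_space "return X x" using xy by (intro prob_space_return)
  interpret BA: pair_prob_space "return X x" "KYX x" ..
  have sets_Y [measurable_cong]: "sets (KYX x) = sets Y" using conditional_Y xy by blast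
  have [measurable]: "f \<in> borel_measurable (X \<Otimes>\<^sub>M Y)"
    using f bounded_fun_measurable by (simp add: bounded_fun_J)
  have "sets (return X x \<Otimes>\<^sub>M KYX x) = sets J"
    unfolding sets_J by (intro sets_pair_measure_cong) (simp_all add: sets_Y)
  then have "f \<in> bounded_fun (return X x \<Otimes>\<^sub>M KYX x)"
    using f bounded_fun_sets_cong by blast
  then have "integrable (return X x \<Otimes>\<^sub>M KYX x) f"
    by (rule BA.P.integrable_bounded_fun)
  from BA.integral_fst'[OF this]
  have "kop update_Y f (x, y) = (\<integral>u. (\<integral>v. f (u, v) \<partial>KYX x) \<partial>return X x)"
    by (simp add: kop_def update_Y_def)
  also have "\<dots> = (\<integral>v. f (x, v) \<partial>KYX x)"
    using xy by (intro integral_return) auto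
  finally show ?thesis .
qed

lemma emeasure_update_X:
  assumes "(x, y) \<in> space J" "A \<in> sets X" "B \<in> sets Y"
  shows "emeasure (update_X (x, y)) (A \<times> B) = emeasure (KXY y) A * indicator B y"
proof -
  have y: "y \<in> space Y" using assms by (auto simp: space_J)
  interpret B: prob_space "return Y y" using y by (intro prob_space_return)
  show ?thesis
    using assms y conditional_X[OF y] by (simp add: update_X_def B.emeasure_pair_measure_Times)
qed

lemma emeasure_update_Y:
  assumes "(x, y) \<in> space J" "A \<in> sets X" "B \<in> sets Y"
  shows "emeasure (update_Y (x, y)) (A \<times> B) = emeasure (KYX x) B * indicator A x"
proof -
  have x: "x \<in> space X" using assms by (auto simp: space_J)
  interpret A: prob_space "KYX x" using conditional_Y[OF x] by blast
  show ?thesis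
    using assms x conditional_Y[OF x] by (simp add: update_Y_def A.emeasure_pair_measure_Times mult.commute)
qed

lemma J_in_prob_algebra: "J \<in> space (prob_algebra J)"
  using prob_space_axioms by (simp add: space_prob_algebra)

text \<open>Invariance of a law under a kernel can be tested on rectangles, where the disintegration applies.\<close>
lemma invariantI:
  assumes K: "K \<in> J \<rightarrow>\<^sub>M prob_algebra J"
    and rect: "\<And>A B. A \<in> sets X \<Longrightarrow> B \<in> sets Y \<Longrightarrow> (\<integral>\<^sup>+z. emeasure (K z) (A \<times> B) \<partial>J) = emeasure J (A \<times> B)"
    and f: "f \<in> bounded_fun J"
  shows "(\<integral>z. kop K f z \<partial>J) = (\<integral>z. f z \<partial>J)"
proof -
  let ?E = "{A \<times> B | A B. A \<in> sets X \<and> B \<in> sets Y}" and ?O = "space X \<times> space Y"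
  have "bind J K = J"
  proof (rule measure_eqI_generator_eq[where E="?E" and \<Omega>="?O" and A="\<lambda>_. ?O"])
    show "Int_stable ?E" by (rule Int_stable_pair_measure_generator)
    show "?E \<subseteq> Pow ?O" by (rule pair_measure_closed)
    show "sets J = sigma_sets ?O ?E" unfolding sets_J by (rule sets_pair_measure)
    then show "sets (bind J K) = sigma_sets ?O ?E"
      using sets_bind'[OF J_in_prob_algebra K] by simp
    fix C assume "C \<in> ?E"
    then obtain A B where C: "C = A \<times> B" "A \<in> sets X" "B \<in> sets Y" by auto
    then have "C \<in> sets J" by (simp add: sets_J)
    then have "emeasure (bind J K) C = (\<integral>\<^sup>+z. emeasure (K z) C \<partial>J)"
      by (rule emeasure_bind_prob_algebra[OF J_in_prob_algebra K])
    then show "emeasure (bind J K) C = emeasure J C" using C rect by simp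
  next
    show "emeasure (bind J K) ?O \<noteq> \<infinity>" for i :: nat
      using prob_space_bind'[OF J_in_prob_algebra K] 
      by (metis finite_measure.emeasure_finite infinity_ennreal_def prob_space.finite_measure)
  qed auto
  then show ?thesis
    using integral_bind_bounded[OF J_in_prob_algebra K f] by (simp add: kop_def)
qed

lemma sets_J_cong [measurable_cong]: "sets J = sets (X \<Otimes>\<^sub>M Y)"
  by (rule sets_J)

sublocale two_averaging_kernels J update_X update_Y
proof
  have [measurable]: "KXY \<in> Y \<rightarrow>\<^sub>M subprob_algebra X" "KYX \<in> X \<rightarrow>\<^sub>M subprob_algebra Y"
    by (simp_all add: measurable_prob_algebraD)
  fix f assume f: "f \<in> bounded_fun J"
  show "(\<integral>z. kop update_X f z \<partial>J) = (\<integral>z. f z \<partial>J)"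
  proof (rule invariantI[OF K1.kernel _ f])
    fix A B assume [measurable]: "A \<in> sets X" "B \<in> sets Y"
    have "(\<integral>\<^sup>+z. emeasure (update_X z) (A \<times> B) \<partial>J) = (\<integral>\<^sup>+z. emeasure (KXY (snd z)) A * indicator B (snd z) \<partial>J)"
      by (intro nn_integral_cong) (auto simp: emeasure_update_X)
    also have "\<dots> = (\<integral>\<^sup>+y\<in>B. emeasure (KXY y) A \<partial>marginal_Y Y J)"
      unfolding marginal_Y_def by (subst nn_integral_distr) auto
    also have "\<dots> = emeasure J (A \<times> B)"
      using XY by (simp add: full_conditional_XY_def)
    finally show "(\<integral>\<^sup>+z. emeasure (update_X z) (A \<times> B) \<partial>J) = emeasure J (A \<times> B)" .
  qed
  show "(\<integral>z. kop update_Y f z \<partial>J) = (\<integral>z. f z \<partial>J)"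
  proof (rule invariantI[OF K2.kernel _ f])
    fix A B assume [measurable]: "A \<in> sets X" "B \<in> sets Y"
    have "(\<integral>\<^sup>+z. emeasure (update_Y z) (A \<times> B) \<partial>J) = (\<integral>\<^sup>+z. emeasure (KYX (fst z)) B * indicator A (fst z) \<partial>J)"
      by (intro nn_integral_cong) (auto simp: emeasure_update_Y)
    also have "\<dots> = (\<integral>\<^sup>+x\<in>A. emeasure (KYX x) B \<partial>marginal_X X J)"
      unfolding marginal_X_def by (subst nn_integral_distr) auto
    also have "\<dots> = emeasure J (A \<times> B)"
      using YX by (simp add: full_conditional_YX_def)
    finally show "(\<integral>\<^sup>+z. emeasure (update_Y z) (A \<times> B) \<partial>J) = emeasure J (A \<times> B)" .
  qed
next
  fix f g z assume f: "f \<in> bounded_fun J" and g: "g \<in> bounded_fun J" and z: "z \<in> space J"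
  obtain x y where xy: "z = (x, y)" by (cases z)
  then have sp: "x \<in> space X" "y \<in> space Y" using z by (auto simp: space_J)
  have "kop update_X (\<lambda>u. f u * kop update_X g u) z = (\<integral>u. f (u, y) * kop update_X g (u, y) \<partial>KXY y)"
    unfolding xy by (rule kop_update_X) (use f g z xy in \<open>auto intro!: bounded_fun_times K1.kop_bounded\<close>)
  also have "\<dots> = (\<integral>u. f (u, y) * kop update_X g z \<partial>KXY y)"
    by (simp add: kop_def update_X_def xy)
  also have "\<dots> = kop update_X f z * kop update_X g z"
    using kop_update_X[OF f] z xy by simp
  finally show "kop update_X (\<lambda>u. f u * kop update_X g u) z = kop update_X f z * kop update_X g z" .
  have "kop update_Y (\<lambda>u. f u * kop update_Y g u) z = (\<integral>v. f (x, v) * kop update_Y g (x, v) \<partial>KYX x)"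
    unfolding xy by (rule kop_update_Y) (use f g z xy in \<open>auto intro!: bounded_fun_times K2.kop_bounded\<close>)
  also have "\<dots> = (\<integral>v. f (x, v) * kop update_Y g z \<partial>KYX x)"
    by (simp add: kop_def update_Y_def xy)
  also have "\<dots> = kop update_Y f z * kop update_Y g z"
    using kop_update_Y[OF f] z xy by simp
  finally show "kop update_Y (\<lambda>u. f u * kop update_Y g u) z = kop update_Y f z * kop update_Y g z" .
qed

lemma composed_DG: "composed_averaging_kernels J update_X update_Y (DG_kernel X Y KXY KYX)"
proof
  have DG: "DG_kernel X Y KXY KYX = (\<lambda>z. bind (KYX (fst z)) (\<lambda>y'. KXY y' \<Otimes>\<^sub>M return Y y'))"
    by (auto simp: DG_kernel_def)
  have step: "(\<lambda>y'. KXY y' \<Otimes>\<^sub>M return Y y') \<in> Y \<rightarrow>\<^sub>M prob_algebra (X \<Otimes>\<^sub>M Y)"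
    by measurable
  show "DG_kernel X Y KXY KYX \<in> J \<rightarrow>\<^sub>M prob_algebra J"
    unfolding DG measurable_J by (rule measurable_bind_prob_space[OF _ step]) measurable
  fix f z assume f: "f \<in> bounded_fun J" and z: "z \<in> space J"
  obtain x y where xy: "z = (x, y)" "x \<in> space X" "y \<in> space Y" using z by (auto simp: space_J)
  have "kop (DG_kernel X Y KXY KYX) f z = (\<integral>y'. (\<integral>u. f u \<partial>(KXY y' \<Otimes>\<^sub>M return Y y')) \<partial>KYX x)"
    unfolding kop_def DG xy fst_conv
    by (rule integral_bind_bounded[OF measurable_space[OF KYX xy(2)] step])
      (use f in \<open>simp add: bounded_fun_J\<close>)
  also have "\<dots> = (\<integral>y'. kop update_X f (x, y') \<partial>KYX x)"
    by (simp add: kop_def update_X_def)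
  also have "\<dots> = kop update_Y (kop update_X f) z"
    unfolding xy by (rule kop_update_Y[symmetric]) (use K1.kop_bounded[OF f] z xy in auto)
  finally show "kop (DG_kernel X Y KXY KYX) f z = kop update_Y (kop update_X f) z" .
qed

text \<open>
Written as a mixture over a coin toss, the random-scan kernel inherits measurability and the integral
formula from the monadic bind.
\<close>
lemma RG_kernel_bind:
  assumes r: "0 < r" "r < 1" and z: "z \<in> space J"
  shows "RG_kernel X Y r KXY KYX z
    = bind (measure_pmf (bernoulli_pmf r)) (\<lambda>b. if b then update_X z else update_Y z)" (is "_ = ?B")
proof -
  obtain x y where xy: "z = (x, y)" by (cases z)
  have pmf: "measure_pmf (bernoulli_pmf r) \<in> space (prob_algebra (count_space UNIV))"
    by (simp add: space_prob_algebra prob_space_measure_pmf)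
  have br: "(\<lambda>b. if b then update_X z else update_Y z) \<in> count_space UNIV \<rightarrow>\<^sub>M prob_algebra J"
    using measurable_space[OF K1.kernel z] measurable_space[OF K2.kernel z] by auto
  have sets_B: "sets ?B = sets (X \<Otimes>\<^sub>M Y)"
    using sets_bind'[OF pmf br] sets_J by simp
  have em: "emeasure ?B E = ennreal r * emeasure (update_X z) E + ennreal (1 - r) * emeasure (update_Y z) E"
    if "E \<in> sets (X \<Otimes>\<^sub>M Y)" for E
    using emeasure_bind_prob_algebra[OF pmf br, of E] that r sets_J
    by (simp add: nn_integral_bernoulli_pmf mult.commute)
  have "?B = measure_of (space ?B) (sets ?B) (emeasure ?B)" by (rule measure_of_of_measure[symmetric])
  also have "\<dots> = measure_of (space (X \<Otimes>\<^sub>M Y)) (sets (X \<Otimes>\<^sub>M Y)) (emeasure ?B)"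
    using sets_B sets_eq_imp_space_eq[OF sets_B] by simp
  also have "\<dots> = RG_kernel X Y r KXY KYX z"
    unfolding RG_kernel_def xy prod.case
    by (rule measure_of_eq)
      (use em[unfolded xy] in \<open>auto simp: update_X_def update_Y_def sets.space_closed sets.sigma_sets_eq\<close>)
  finally show ?thesis by simp
qed

lemma mixed_RG:
  assumes r: "0 < r" "r < 1"
  shows "mixed_averaging_kernels J update_X update_Y (RG_kernel X Y r KXY KYX) r"
proof
  show "0 < r" "r < 1" by (rule r)+
  have pmf: "measure_pmf (bernoulli_pmf r) \<in> space (prob_algebra (count_space UNIV))"
    by (simp add: space_prob_algebra prob_space_measure_pmf)
  have "(\<lambda>z. bind (measure_pmf (bernoulli_pmf r)) (\<lambda>b. if b then update_X z else update_Y z)) \<in> J \<rightarrow>\<^sub>M prob_algebra J"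
  proof (rule measurable_bind_prob_space2[OF measurable_const[OF pmf]])
    show "(\<lambda>(z, b). if b then update_X z else update_Y z) \<in> J \<Otimes>\<^sub>M count_space UNIV \<rightarrow>\<^sub>M prob_algebra J"
      by measurable
  qed
  then show "RG_kernel X Y r KXY KYX \<in> J \<rightarrow>\<^sub>M prob_algebra J"
    by (subst measurable_cong[OF RG_kernel_bind[OF r]])
  fix f z assume f: "f \<in> bounded_fun J" and z: "z \<in> space J"
  have br: "(\<lambda>b. if b then update_X z else update_Y z) \<in> count_space UNIV \<rightarrow>\<^sub>M prob_algebra J"
    using measurable_space[OF K1.kernel z] measurable_space[OF K2.kernel z] by auto
  have "kop (RG_kernel X Y r KXY KYX) f z
      = (\<integral>b. (\<integral>u. f u \<partial>(if b then update_X z else update_Y z)) \<partial>measure_pmf (bernoulli_pmf r))"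
    unfolding kop_def RG_kernel_bind[OF r z] by (rule integral_bind_bounded[OF pmf br f])
  also have "\<dots> = r * kop update_X f z + (1 - r) * kop update_Y f z"
    using r by (simp add: integral_bernoulli_pmf kop_def mult.commute)
  finally show "kop (RG_kernel X Y r KXY KYX) f z = r * kop update_X f z + (1 - r) * kop update_Y f z" .
qed

end

section \<open>Comparison\<close>

text \<open>The mean cost \<open>r t1 + (1 - r) t2\<close> of a random-scan step is at least \<open>min r (1 - r)\<close> times the cost of a sweep.\<close>
lemma cost_ratio_le:
  fixes r t1 t2 :: real
  assumes "0 < r" "r < 1" "0 < t1" "0 < t2"
  shows "(t1 + t2) / (r * t1 + (1 - r) * t2) \<le> max (1 / r) (1 / (1 - r))"
proof -
  have pos: "0 < r * t1 + (1 - r) * t2" using assms by (intro add_pos_pos) auto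
  show ?thesis
  proof (cases "r \<le> 1 - r")
    case True
    then have "r * (t1 + t2) \<le> r * t1 + (1 - r) * t2"
      using assms by (simp add: distrib_left)
    then have "(t1 + t2) / (r * t1 + (1 - r) * t2) \<le> 1 / r"
      using pos assms by (simp add: divide_le_eq field_simps)
    then show ?thesis by simp
  next
    case False
    then have "(1 - r) * (t1 + t2) \<le> r * t1 + (1 - r) * t2"
      using assms by (simp add: distrib_left)
    then have "(t1 + t2) / (r * t1 + (1 - r) * t2) \<le> 1 / (1 - r)"
      using pos assms by (simp add: divide_le_eq field_simps)
    then show ?thesis by simp
  qed
qed

theorem mainTheorem2:
  fixes X :: "'a measure" and Y :: "'b measure"
    and J :: "('a \<times> 'b) measure"
    and KXY :: "'b \<Rightarrow> 'a measure" and KYX :: "'a \<Rightarrow> 'b measure"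
    and r t1 t2 kD kR :: real
  assumes "prob_space J"
    and "sets J = sets (X \<Otimes>\<^sub>M Y)"
    and "full_conditional_XY X Y J KXY"
    and "full_conditional_YX X Y J KYX"
    and "\<exists>A1\<in>sets X. \<exists>A2\<in>sets X. A1 \<inter> A2 = {} \<and>
           emeasure (marginal_X X J) A1 > 0 \<and> emeasure (marginal_X X J) A2 > 0"
    and "\<exists>B1\<in>sets Y. \<exists>B2\<in>sets Y. B1 \<inter> B2 = {} \<and>
           emeasure (marginal_Y Y J) B1 > 0 \<and> emeasure (marginal_Y Y J) B2 > 0"
    and "0 < r" and "r < 1"
    and "t1 > 0" and "t2 > 0"
    and "kD > 0" and "kR > 0"
    and "kR / kD = (t1 + t2) / (r * t1 + (1 - r) * t2)"
  shows "L2_rate J (DG_kernel X Y KXY KYX) powr kD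
         \<le> L2_rate J (RG_kernel X Y r KXY KYX) powr kR"
proof -
  interpret prob_space J by (rule assms(1))
  interpret joint_law X Y J KXY KYX
    by unfold_locales (rule assms(2-4))+
  interpret composed_and_mixed_kernels J update_X update_Y "DG_kernel X Y KXY KYX" "RG_kernel X Y r KXY KYX" r
    by (intro composed_and_mixed_kernels.intro composed_DG mixed_RG assms)
  show ?thesis
    using L2_rate_powr_le[of kD kR] cost_ratio_le[of r t1 t2] assms by simp
qed

end
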